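(* For every $n\in\mathbb{N}$, $$\sum_{k=0}^{2n+2}(-1)^kG_k\star\tilde{G}_{2n+2-k}=(-1)^{n+1}[2]_q^{2n+1}\big(q^{-1}xyy(xxyy)^nx+qy(xxyy)^nxxy\big),$$ $$\sum_{k=0}^{2n+2}(-1)^k\tilde{G}_{2n+2-k}\star G_k=(-1)^{n+1}[2]_q^{2n+1}\big(qxyy(xxyy)^nx+q^{-1}y(xxyy)^nxxy\big),$$ $$\sum_{k=0}^{2n+1}(-1)^kG_k\star\tilde{G}_{2n+1-k}=(-1)^n[2]_q^{2n}\big(x(yyxx)^ny-y(xxyy)^nx\big),$$ $$\sum_{k=0}^{2n+1}(-1)^k\tilde{G}_{2n+1-k}\star G_k=(-1)^n[2]_q^{2n}\big(x(yyxx)^ny-y(xxyy)^nx\big).$$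
   Context: Let $\mathbb{F}$ be a field of characteristic zero and let $q\in\mathbb{F}$ be nonzero and not a root of unity; $\mathbb{N}=\{0,1,2,\ldots\}$; $[2]_q=q+q^{-1}$. Let $\mathbb{V}$ be the free associative unital $\mathbb{F}$-algebra on two noncommuting generators (letters) $x,y$; the words in $x,y$ (including the trivial word $\mathbf{1}$) form a basis of $\mathbb{V}$. Words such as $(xxyy)^nx$ are written with respect to the free (concatenation) product. The $q$-shuffle product $\star$ on the vector space $\mathbb{V}$ is the bilinear associative product with unit $\mathbf{1}$ determined as follows. Put $\langle x,x\rangle=\langle y,y\rangle=2$ and $\langle x,y\rangle=\langle y,x\rangle=-2$. For nontrivial words $u=u_1\cdots u_r$ and $v=v_1\cdots v_s$, $$u\star v=u_1\big((u_2\cdots u_r)\star v\big)+v_1\big(u\star(v_2\cdots v_s)\big)q^{\langle v_1,u_1\rangle+\cdots+\langle v_1,u_r\rangle}.$$ The alternating words are, for $n\in\mathbb{N}$ (powers in the free product): $\tilde{G}_{n+1}=(xy)^{n+1}$, $G_{n+1}=(yx)^{n+1}$, $W_{-n}=(xy)^nx$, $W_{n+1}=(yx)^ny$; also $G_0=\tilde{G}_0=\mathbf{1}$. *)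

theory Defs
  imports "HOL-Library.Poly_Mapping"
begin

datatype letter = X | Y

text \<open>
  Words are lists of letters.  The library turns finitely supported functions \<open>'w \<Rightarrow>\<^sub>0 'a\<close>
  on an additively written monoid into its monoid algebra, with convolution as multiplication.
  Writing concatenation of lists as addition, \<open>letter list \<Rightarrow>\<^sub>0 'a\<close> is the free unital
  associative algebra on two generators: \<open>*\<close>, \<open>^\<close> and \<open>1\<close> are those of the free product.
\<close>

instantiation list :: (type) monoid_add
begin

definition zero_list_def: "0 = []"
definition plus_list_def: "u + v = u @ v"

instance
  by standard (simp_all add: zero_list_def plus_list_def)

end

type_synonym 'a free_alg = "letter list \<Rightarrow>\<^sub>0 'a"

definition of_word :: "letter list \<Rightarrow> 'a::field free_alg" where
  "of_word w = Poly_Mapping.single w 1"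

definition scale :: "'a::field \<Rightarrow> 'a free_alg \<Rightarrow> 'a free_alg"  (infixr \<open>\<cdot>\<close> 75) where
  "c \<cdot> f = Poly_Mapping.map (\<lambda>a. c * a) f"

lemma one_free_alg: "1 = (of_word [] :: 'a::field free_alg)"
  by (simp add: of_word_def zero_list_def flip: single_one)

lemma of_word_append: "of_word (u @ v) = (of_word u * of_word v :: 'a::field free_alg)"
  by (simp add: of_word_def mult_single plus_list_def)

lemma lookup_scale: "Poly_Mapping.lookup (c \<cdot> f) w = c * Poly_Mapping.lookup f w"
  by (simp add: scale_def map.rep_eq when_def)

definition pairing :: "letter \<Rightarrow> letter \<Rightarrow> int" where
  "pairing a b = (if a = b then 2 else - 2)"

fun qshuffle_word :: "'a::field \<Rightarrow> letter list \<Rightarrow> letter list \<Rightarrow> 'a free_alg" where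
  "qshuffle_word q [] v = of_word v"
| "qshuffle_word q u [] = of_word u"
| "qshuffle_word q (a # u) (b # v) =
     of_word [a] * qshuffle_word q u (b # v) +
     (q powi (\<Sum>c\<leftarrow>a # u. pairing b c)) \<cdot> (of_word [b] * qshuffle_word q (a # u) v)"

definition qshuffle :: "'a::field \<Rightarrow> 'a free_alg \<Rightarrow> 'a free_alg \<Rightarrow> 'a free_alg" where
  "qshuffle q f g =
     (\<Sum>u\<in>Poly_Mapping.keys f. \<Sum>v\<in>Poly_Mapping.keys g.
        (Poly_Mapping.lookup f u * Poly_Mapping.lookup g v) \<cdot> qshuffle_word q u v)"

text \<open>Only \<open>qshuffle_word\<close> is defined by recursion; the product is its bilinear extension.\<close>

lemma qshuffle_of_word: "qshuffle q (of_word u) (of_word v) = qshuffle_word q u v"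
  by (rule poly_mapping_eqI) (simp add: qshuffle_def of_word_def lookup_scale)

lemma qshuffle_superset:
  assumes "finite A" "Poly_Mapping.keys f \<subseteq> A" "finite B" "Poly_Mapping.keys g \<subseteq> B"
  shows "qshuffle q f g =
     (\<Sum>u\<in>A. \<Sum>v\<in>B.
        (Poly_Mapping.lookup f u * Poly_Mapping.lookup g v) \<cdot> qshuffle_word q u v)"
proof -
  have z: "0 \<cdot> h = 0" for h :: "'a free_alg"
    by (rule poly_mapping_eqI) (simp add: lookup_scale)
  have "qshuffle q f g = (\<Sum>u\<in>Poly_Mapping.keys f. \<Sum>v\<in>B.
        (Poly_Mapping.lookup f u * Poly_Mapping.lookup g v) \<cdot> qshuffle_word q u v)"
    unfolding qshuffle_def
    by (intro sum.cong refl sum.mono_neutral_left) (use assms in \<open>auto simp: in_keys_iff z\<close>)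
  also have "\<dots> = (\<Sum>u\<in>A. \<Sum>v\<in>B.
        (Poly_Mapping.lookup f u * Poly_Mapping.lookup g v) \<cdot> qshuffle_word q u v)"
    by (intro sum.mono_neutral_left) (use assms in \<open>auto simp: in_keys_iff z intro!: sum.neutral\<close>)
  finally show ?thesis .
qed

lemma scale_left_distrib: "(a + b) \<cdot> f = a \<cdot> f + b \<cdot> f"
  by (rule poly_mapping_eqI) (simp add: lookup_scale lookup_add algebra_simps)

lemma scale_scale: "a \<cdot> b \<cdot> f = (a * b) \<cdot> f"
  by (rule poly_mapping_eqI) (simp add: lookup_scale algebra_simps)

lemma scale_sum: "a \<cdot> sum F S = (\<Sum>i\<in>S. a \<cdot> F i)"
  by (rule poly_mapping_eqI) (simp add: lookup_scale lookup_sum sum_distrib_left)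

lemma keys_scale: "Poly_Mapping.keys (c \<cdot> f) \<subseteq> Poly_Mapping.keys f"
  by (auto simp: in_keys_iff lookup_scale)

lemma qshuffle_add_left: "qshuffle q (f + f') g = qshuffle q f g + qshuffle q f' g"
proof -
  let ?A = "Poly_Mapping.keys f \<union> Poly_Mapping.keys f'"
  have "Poly_Mapping.keys (f + f') \<subseteq> ?A" by (rule Poly_Mapping.keys_add)
  then show ?thesis
    by (simp add: qshuffle_superset[of ?A _ "Poly_Mapping.keys g"] lookup_add distrib_right
        scale_left_distrib sum.distrib)
qed

lemma qshuffle_add_right: "qshuffle q f (g + g') = qshuffle q f g + qshuffle q f g'"
proof -
  let ?B = "Poly_Mapping.keys g \<union> Poly_Mapping.keys g'"
  have "Poly_Mapping.keys (g + g') \<subseteq> ?B" by (rule Poly_Mapping.keys_add)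
  then show ?thesis
    by (simp add: qshuffle_superset[of "Poly_Mapping.keys f" _ ?B] lookup_add distrib_left
        scale_left_distrib sum.distrib)
qed

lemma qshuffle_scale_left: "qshuffle q (c \<cdot> f) g = c \<cdot> qshuffle q f g"
  by (simp add: qshuffle_superset[of "Poly_Mapping.keys f" _ "Poly_Mapping.keys g"] keys_scale
      lookup_scale scale_sum scale_scale mult_ac)

lemma qshuffle_scale_right: "qshuffle q f (c \<cdot> g) = c \<cdot> qshuffle q f g"
  by (simp add: qshuffle_superset[of "Poly_Mapping.keys f" _ "Poly_Mapping.keys g"] keys_scale
      lookup_scale scale_sum scale_scale mult_ac)

text \<open>\<open>Gt\<close> is the alternating word usually written $\tilde G$; powers are in the free product.\<close>

definition G :: "nat \<Rightarrow> 'a::field free_alg" where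
  "G n = of_word [Y, X] ^ n"

definition Gt :: "nat \<Rightarrow> 'a::field free_alg" where
  "Gt n = of_word [X, Y] ^ n"

text \<open>The quantum integer \<open>[2]\<^sub>q\<close>.\<close>

definition qtwo :: "'a::field \<Rightarrow> 'a" where
  "qtwo q = q + inverse q"

end

theory Submission
  imports Defs
begin

text \<open>
  Besides the given sums, consider the alternating sums of \<open>u \<star> v\<close> in which
  exactly one of \<open>u\<close>, \<open>v\<close> has lost its first letter, and those in which both have.
  The defining recursion of \<open>\<star>\<close> relates these families linearly.  Eliminating the sums with two even
  or two odd factors leaves a two-term recursion in which each step only prefixes a square of a letter
  and multiplies by a scalar, so two steps prefix \<open>xxyy\<close> or \<open>yyxx\<close> and multiply
  by \<open>-[2]\<^sub>q\<^sup>2\<close>.  Swapping the letters reverses the order of the factors.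
\<close>

section \<open>Scalars in the free algebra\<close>

lemma scale_one: "1 \<cdot> f = f"
  by (rule poly_mapping_eqI) (simp add: lookup_scale)

lemma scale_right_distrib: "c \<cdot> (f + g) = c \<cdot> f + c \<cdot> g"
  by (rule poly_mapping_eqI) (simp add: lookup_scale lookup_add algebra_simps)

lemma scale_right_diff: "c \<cdot> (f - g) = c \<cdot> f - c \<cdot> g"
  by (rule poly_mapping_eqI) (simp add: lookup_scale lookup_minus algebra_simps)

lemma scale_minus_left: "(- c) \<cdot> f = - (c \<cdot> f)"
  by (rule poly_mapping_eqI) (simp add: lookup_scale)

lemma scale_minus_right: "c \<cdot> (- f) = - (c \<cdot> f)"
  by (rule poly_mapping_eqI) (simp add: lookup_scale)

lemma scale_eq_mult: "c \<cdot> f = Poly_Mapping.single 0 c * f"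
  by (simp add: scale_def mult_map_scale_conv_mult)

text \<open>Scalars are central although the free product is not commutative: convolving with a
  function supported at the empty word only rescales coefficients.\<close>

lemma scale_eq_mult_right: "c \<cdot> f = f * Poly_Mapping.single 0 c"
proof (rule poly_mapping_eqI)
  fix w :: "letter list"
  have "(\<Sum>q. Poly_Mapping.lookup (Poly_Mapping.single 0 c) q when w = l + q) = (c when l = w)" for l
  proof -
    have "(\<Sum>q. Poly_Mapping.lookup (Poly_Mapping.single 0 c) q when w = l + q) =
        (\<Sum>q :: letter list. (c when l = w) when q = [])"
      by (rule arg_cong[where f = Sum_any]) (auto simp: fun_eq_iff lookup_single when_def plus_list_def zero_list_def)
    then show ?thesis by simp
  qed
  then show "Poly_Mapping.lookup (c \<cdot> f) w = Poly_Mapping.lookup (f * Poly_Mapping.single 0 c) w"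
    by (simp add: lookup_mult lookup_scale mult_when mult.commute)
qed

lemma mult_scale_left: "(c \<cdot> f) * g = c \<cdot> (f * g)"
  by (simp add: scale_eq_mult mult.assoc)

lemma mult_scale_right: "f * (c \<cdot> g) = c \<cdot> (f * g)"
  by (simp add: scale_eq_mult_right mult.assoc)

lemmas scale_simps = scale_scale scale_one scale_right_distrib scale_right_diff
  scale_minus_left scale_minus_right mult_scale_left mult_scale_right

lemma power_mult_slide:
  fixes a b :: "'a::monoid_mult"
  shows "(a * b) ^ n * a = a * (b * a) ^ n"
  by (induction n) (simp_all add: mult.assoc)

text \<open>For sums whose end terms obey only half of a recursion, because one factor is the empty
  word there: \<open>f 0\<close> has no \<open>g\<close> part and \<open>f (Suc N)\<close> no
  \<open>h\<close> part.\<close>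

lemma sum_atMost_Suc_overlap:
  fixes f g h :: "nat \<Rightarrow> 'a::comm_monoid_add"
  assumes "f 0 = h 0" and "f (Suc N) = g N"
    and "\<And>k. k < N \<Longrightarrow> f (Suc k) = g k + h (Suc k)"
  shows "(\<Sum>k\<le>Suc N. f k) = (\<Sum>k\<le>N. g k) + (\<Sum>k\<le>N. h k)"
proof -
  have "(\<Sum>k\<le>Suc N. f k) = f 0 + (\<Sum>k<N. f (Suc k)) + f (Suc N)"
    by (simp only: sum.atMost_Suc) (simp only: sum.atMost_shift)
  also have "\<dots> = ((\<Sum>k<N. g k) + g N) + (h 0 + (\<Sum>k<N. h (Suc k)))"
    by (simp add: assms sum.distrib add_ac)
  also have "\<dots> = (\<Sum>k\<le>N. g k) + (\<Sum>k\<le>N. h k)"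
    unfolding sum.atMost_shift[of h] by (simp flip: lessThan_Suc_atMost)
  finally show ?thesis .
qed

text \<open>Alternating words are indexed by their last letter \<open>a\<close>, which is stable under the
  removal of the first letter.\<close>

fun alt :: "letter \<Rightarrow> letter \<Rightarrow> nat \<Rightarrow> letter list" where
  "alt a b 0 = []"
| "alt a b (Suc m) = (if even m then a else b) # alt a b m"

lemma of_word_two_squares: "of_word [c, c, d, d] =
    (of_word [c] * of_word [c] * (of_word [d] * of_word [d]) :: 'a::field free_alg)"
  by (simp flip: of_word_append)

lemma of_word_alt_Suc:
  "of_word (alt c d (Suc m)) = (of_word [if even m then c else d] * of_word (alt c d m) :: 'a::field free_alg)"
  by (simp flip: of_word_append)

text \<open>Both sides spell the same word: moving \<open>aa\<close> across a power of
  \<open>bbaa\<close> turns it into a power of \<open>aabb\<close>.\<close>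

lemma of_word_slide:
  "of_word [b, a, a] * of_word [b, b, a, a] ^ n * of_word [b] =
    (of_word [b] * of_word [a, a, b, b] ^ n * of_word [a, a, b] :: 'a::field free_alg)"
proof -
  have split: "of_word [b, a, a] = (of_word [b] * (of_word [a] * of_word [a]) :: 'a free_alg)"
    "of_word [a, a, b] = (of_word [a] * of_word [a] * of_word [b] :: 'a free_alg)"
    by (simp_all flip: of_word_append)
  have slide: "of_word [a, a, b, b] ^ n * (of_word [a] * of_word [a]) =
      (of_word [a] * of_word [a] * of_word [b, b, a, a] ^ n :: 'a free_alg)"
    by (simp only: of_word_two_squares power_mult_slide)
  have "of_word [b, a, a] * of_word [b, b, a, a] ^ n * of_word [b] =
      (of_word [b] * (of_word [a] * of_word [a] * of_word [b, b, a, a] ^ n) * of_word [b] :: 'a free_alg)"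
    by (simp only: split mult.assoc)
  also have "\<dots> = of_word [b] * of_word [a, a, b, b] ^ n * of_word [a, a, b]"
    unfolding slide[symmetric] by (simp only: split mult.assoc)
  finally show ?thesis .
qed

lemma of_word_alt_even: "of_word (alt a b (2 * k)) = (of_word [b, a] :: 'a::field free_alg) ^ k"
proof (induction k)
  case (Suc k)
  have "alt a b (2 * Suc k) = [b, a] @ alt a b (2 * k)" by simp
  then show ?case using Suc by (simp only: of_word_append power_Suc)
qed (simp add: one_free_alg)

text \<open>Neighbouring letters differ, so their pairings with \<open>d\<close> cancel; an odd
  length leaves one \<open>a\<close> over.\<close>

lemma sum_pairing_alt:
  assumes "a \<noteq> b"
  shows "(\<Sum>c\<leftarrow>alt a b m. pairing d c) = (if even m then 0 else pairing d a)"
  using assms by (induction m; cases a; cases b; cases d) (auto simp: pairing_def)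

section \<open>Products of alternating words and their recursion by parity\<close>

context
  fixes q :: "'a::field" and a b :: letter
  assumes q: "q \<noteq> 0" and ab: "a \<noteq> b"
begin

text \<open>For \<open>a = X\<close> and \<open>b = Y\<close>, even lengths \<open>2 * k\<close>,
  \<open>2 * l\<close> give the product of \<open>G k\<close> and \<open>Gt l\<close>. The letters
  stay generic so that exchanging them covers the opposite order.\<close>

definition alt_prod :: "nat \<Rightarrow> nat \<Rightarrow> 'a free_alg" where
  "alt_prod m l = qshuffle_word q (alt a b m) (alt b a l)"

lemma alt_prod_0_left: "alt_prod 0 l = of_word (alt b a l)"
  by (simp add: alt_prod_def)

lemma alt_prod_0_right: "alt_prod m 0 = of_word (alt a b m)"
  by (cases m) (simp_all add: alt_prod_def)

text \<open>Only a left factor of odd length yields a power of \<open>q\<close>; its sign depends on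
  whether the right factor begins with \<open>a\<close> or \<open>b\<close>, that is, on the parity
  of \<open>l\<close>.\<close>

lemma alt_prod_Suc:
  "alt_prod (Suc m) (Suc l) =
     of_word [if even m then a else b] * alt_prod m (Suc l) +
     (q powi (if even m then if even l then - 2 else 2 else 0)) \<cdot>
       (of_word [if even l then b else a] * alt_prod (Suc m) l)"
proof -
  have "(\<Sum>c\<leftarrow>alt a b (Suc m). pairing (if even l then b else a) c) =
      (if even m then if even l then - 2 else 2 else 0)"
    unfolding sum_pairing_alt[OF ab] using ab by (simp add: pairing_def)
  then show ?thesis by (simp add: alt_prod_def)
qed

lemma alt_prod_even_even:
  "alt_prod (2 * k + 2) (2 * l + 2) =
     of_word [b] * alt_prod (2 * k + 1) (2 * l + 2) + of_word [a] * alt_prod (2 * k + 2) (2 * l + 1)"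
  using alt_prod_Suc[of "2 * k + 1" "2 * l + 1"] by (simp add: scale_one)

lemma alt_prod_odd_even:
  "alt_prod (2 * k + 1) (2 * l + 2) =
     of_word [a] * alt_prod (2 * k) (2 * l + 2) +
     q\<^sup>2 \<cdot> (of_word [a] * alt_prod (2 * k + 1) (2 * l + 1))"
  using alt_prod_Suc[of "2 * k" "2 * l + 1"] by simp

lemma alt_prod_even_odd:
  "alt_prod (2 * k + 2) (2 * l + 1) =
     of_word [b] * alt_prod (2 * k + 1) (2 * l + 1) + of_word [b] * alt_prod (2 * k + 2) (2 * l)"
  using alt_prod_Suc[of "2 * k + 1" "2 * l"] by (simp add: scale_one)

lemma alt_prod_odd_odd:
  "alt_prod (2 * k + 1) (2 * l + 1) =
     of_word [a] * alt_prod (2 * k) (2 * l + 1) +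
     (inverse q)\<^sup>2 \<cdot> (of_word [b] * alt_prod (2 * k + 1) (2 * l))"
  using alt_prod_Suc[of "2 * k" "2 * l"] by (simp add: power_int_minus power_inverse)

section \<open>Alternating sums by the parities of both lengths, and their linear relations\<close>

definition sum_ee :: "nat \<Rightarrow> 'a free_alg" where
  "sum_ee N = (\<Sum>k\<le>N. (-1) ^ k \<cdot> alt_prod (2 * k) (2 * (N - k)))"

definition sum_oe :: "nat \<Rightarrow> 'a free_alg" where
  "sum_oe N = (\<Sum>k\<le>N. (-1) ^ k \<cdot> alt_prod (2 * k + 1) (2 * (N - k)))"

definition sum_eo :: "nat \<Rightarrow> 'a free_alg" where
  "sum_eo N = (\<Sum>k\<le>N. (-1) ^ k \<cdot> alt_prod (2 * k) (2 * (N - k) + 1))"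

definition sum_oo :: "nat \<Rightarrow> 'a free_alg" where
  "sum_oo N = (\<Sum>k\<le>N. (-1) ^ k \<cdot> alt_prod (2 * k + 1) (2 * (N - k) + 1))"

text \<open>The minus sign arises because shortening the left factor from \<open>2 * k + 2\<close>
  to \<open>2 * k + 1\<close> lowers the index carrying the sign by one.\<close>

lemma sum_ee_Suc: "sum_ee (Suc N) = of_word [a] * sum_eo N - of_word [b] * sum_oe N"
proof -
  let ?f = "\<lambda>k. (-1) ^ k \<cdot> alt_prod (2 * k) (2 * (Suc N - k))"
  let ?g = "\<lambda>k. - ((-1) ^ k \<cdot> (of_word [b] * alt_prod (2 * k + 1) (2 * (N - k))))"
  let ?h = "\<lambda>k. (-1) ^ k \<cdot> (of_word [a] * alt_prod (2 * k) (2 * (N - k) + 1))"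
  have "sum_ee (Suc N) = sum ?g {..N} + sum ?h {..N}"
    unfolding sum_ee_def
  proof (rule sum_atMost_Suc_overlap)
    show "?f 0 = ?h 0"
      by (simp add: alt_prod_0_left of_word_alt_Suc del: alt.simps(2))
    show "?f (Suc N) = ?g N"
      by (simp add: alt_prod_0_right of_word_alt_Suc scale_minus_left del: alt.simps(2))
    show "?f (Suc k) = ?g k + ?h (Suc k)" if k: "k < N" for k
    proof -
      \<comment> \<open>This removes the truncated subtraction and shows that both factors are
        nonempty.\<close>
      obtain l where l: "N = k + l + 1"
        using k by (metis add.assoc add.commute less_imp_Suc_add plus_1_eq_Suc)
      show ?thesis
        using alt_prod_even_even[of k l] by (simp add: l scale_simps)
    qed
  qed
  then show ?thesis
    by (simp add: sum_eo_def sum_oe_def sum_distrib_left mult_scale_right sum_negf)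
qed

text \<open>Nonempty factors of these parities both begin with \<open>a\<close>, which comes out in
  front. The last summand has an empty right factor and contributes to \<open>sum_ee\<close> only,
  hence the different indices.\<close>

lemma sum_oe_Suc:
  "sum_oe (Suc N) = of_word [a] * (sum_ee (Suc N) + q\<^sup>2 \<cdot> sum_oo N)"
proof -
  have step: "alt_prod (2 * k + 1) (2 * (Suc N - k)) =
      of_word [a] * alt_prod (2 * k) (2 * (Suc N - k)) +
      q\<^sup>2 \<cdot> (of_word [a] * alt_prod (2 * k + 1) (2 * (N - k) + 1))" if "k \<le> N" for k
    using alt_prod_odd_even[of k "N - k"] that by (simp add: Suc_diff_le)
  have "(\<Sum>k\<le>N. (-1) ^ k \<cdot> alt_prod (2 * k + 1) (2 * (Suc N - k))) =
      (\<Sum>k\<le>N. of_word [a] * ((-1) ^ k \<cdot> alt_prod (2 * k) (2 * (Suc N - k))) +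
        of_word [a] * (q\<^sup>2 \<cdot> ((-1) ^ k \<cdot> alt_prod (2 * k + 1) (2 * (N - k) + 1))))"
    by (intro sum.cong refl, subst step) (auto simp: scale_simps mult.commute)
  then show ?thesis
    by (simp add: sum_oe_def sum_ee_def sum_oo_def sum.distrib distrib_left sum_distrib_left
        scale_sum alt_prod_0_right of_word_alt_Suc scale_simps right_diff_distrib ac_simps del: alt.simps(2))
qed

text \<open>Now the common first letter is \<open>b\<close>, and the empty left factor occurs at
  \<open>k = 0\<close>.\<close>

lemma sum_eo_Suc: "sum_eo (Suc N) = of_word [b] * (sum_ee (Suc N) - sum_oo N)"
proof -
  have step: "alt_prod (2 * Suc k) (2 * (N - k) + 1) =
      of_word [b] * alt_prod (2 * k + 1) (2 * (N - k) + 1) +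
      of_word [b] * alt_prod (2 * Suc k) (2 * (N - k))" for k
    using alt_prod_even_odd[of k "N - k"] by simp
  have "(\<Sum>k\<le>N. (-1) ^ Suc k \<cdot> alt_prod (2 * Suc k) (2 * (N - k) + 1)) =
      (\<Sum>k\<le>N. of_word [b] * ((-1) ^ Suc k \<cdot> alt_prod (2 * Suc k) (2 * (N - k))) -
        of_word [b] * ((-1) ^ k \<cdot> alt_prod (2 * k + 1) (2 * (N - k) + 1)))"
    unfolding step by (simp add: scale_simps minus_diff_commute)
  then show ?thesis
    unfolding sum_eo_def sum_ee_def sum_oo_def sum.atMost_Suc_shift
    by (simp add: sum_subtractf distrib_left right_diff_distrib sum_distrib_left
        scale_one alt_prod_0_left of_word_alt_Suc del: alt.simps(2))
qed

lemma sum_oo_eq: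
  "sum_oo N = of_word [a] * sum_eo N + (inverse q)\<^sup>2 \<cdot> (of_word [b] * sum_oe N)"
  unfolding sum_oo_def alt_prod_odd_odd
  by (simp add: sum_eo_def sum_oe_def sum_distrib_left scale_sum sum.distrib scale_simps mult.commute)

text \<open>Substituting for \<open>sum_ee\<close> and \<open>sum_oo\<close>, the
  \<open>sum_oe\<close> parts cancel since the weights q^2 and q^(-2) multiply to 1.\<close>

lemma sum_oe_Suc_eo:
  "sum_oe (Suc N) = (q * qtwo q) \<cdot> (of_word [a] * of_word [a] * sum_eo N)"
proof -
  have "q * qtwo q = 1 + q\<^sup>2" "q\<^sup>2 * (inverse q)\<^sup>2 = 1"
    using q by (simp_all add: qtwo_def field_simps power2_eq_square)
  then show ?thesis
    by (simp add: sum_oe_Suc sum_ee_Suc sum_oo_eq scale_simps scale_left_distrib algebra_simps)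
qed

text \<open>Here the \<open>sum_eo\<close> parts of \<open>sum_ee\<close> and \<open>sum_oo\<close>
  cancel.\<close>

lemma sum_eo_Suc_oe:
  "sum_eo (Suc N) = - ((inverse q * qtwo q) \<cdot> (of_word [b] * of_word [b] * sum_oe N))"
proof -
  have "inverse q * qtwo q = 1 + (inverse q)\<^sup>2"
    using q by (simp add: qtwo_def field_simps power2_eq_square)
  then show ?thesis
    by (simp add: sum_eo_Suc sum_ee_Suc sum_oo_eq scale_simps scale_left_distrib algebra_simps)
qed

section \<open>Closed forms\<close>

lemma sum_oe_even:
  "sum_oe (2 * n) = ((-1) ^ n * qtwo q ^ (2 * n)) \<cdot> (of_word [a, a, b, b] ^ n * of_word [a])"
proof (induction n)
  case 0
  show ?case by (simp add: sum_oe_def alt_prod_0_right scale_one)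
next
  case (Suc n)
  \<comment> \<open>One step of each kind: the factors \<open>q\<close> and \<open>inverse q\<close>
    cancel.\<close>
  have "sum_oe (2 * Suc n) = - ((qtwo q)\<^sup>2 \<cdot> (of_word [a, a, b, b] * sum_oe (2 * n)))"
    by (simp add: sum_oe_Suc_eo sum_eo_Suc_oe of_word_two_squares scale_simps mult.assoc power2_eq_square)
      (use q in \<open>simp add: field_simps\<close>)
  then show ?case
    by (simp add: Suc scale_simps mult.assoc mult.left_commute power2_eq_square)
qed

lemma sum_eo_even:
  "sum_eo (2 * n) = ((-1) ^ n * qtwo q ^ (2 * n)) \<cdot> (of_word [b, b, a, a] ^ n * of_word [b])"
proof (induction n)
  case 0
  show ?case by (simp add: sum_eo_def alt_prod_0_left scale_one)
next
  case (Suc n)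
  have "sum_eo (2 * Suc n) = - ((qtwo q)\<^sup>2 \<cdot> (of_word [b, b, a, a] * sum_eo (2 * n)))"
    by (simp add: sum_oe_Suc_eo sum_eo_Suc_oe of_word_two_squares scale_simps mult.assoc power2_eq_square)
      (use q in \<open>simp add: field_simps\<close>)
  then show ?case
    by (simp add: Suc scale_simps mult.assoc mult.left_commute power2_eq_square)
qed

lemma sum_ee_odd:
  "sum_ee (2 * n + 1) = ((-1) ^ n * qtwo q ^ (2 * n)) \<cdot>
     (of_word [a] * of_word [b, b, a, a] ^ n * of_word [b] -
      of_word [b] * of_word [a, a, b, b] ^ n * of_word [a])"
  by (simp add: sum_ee_Suc sum_oe_even sum_eo_even scale_simps mult.assoc)

text \<open>Passing from index \<open>2 * n\<close> to \<open>2 * n + 1\<close> takes a single step,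
  so \<open>inverse q\<close> and \<open>q\<close> remain uncancelled, one on each word.\<close>

lemma sum_ee_even:
  "sum_ee (2 * n + 2) = ((-1) ^ (n + 1) * qtwo q ^ (2 * n + 1)) \<cdot>
     (inverse q \<cdot> (of_word [a, b, b] * of_word [a, a, b, b] ^ n * of_word [a]) +
      q \<cdot> (of_word [b] * of_word [a, a, b, b] ^ n * of_word [a, a, b]))"
proof -
  have "of_word [a, b, b] = (of_word [a] * (of_word [b] * of_word [b]) :: 'a free_alg)"
    "of_word [b, a, a] = (of_word [b] * (of_word [a] * of_word [a]) :: 'a free_alg)"
    by (simp_all flip: of_word_append)
  then show ?thesis
    unfolding of_word_slide[symmetric]
    by (simp add: sum_ee_Suc sum_oe_Suc_eo sum_eo_Suc_oe sum_oe_even sum_eo_even scale_simps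
        mult.assoc) (simp add: mult_ac)
qed

lemma sum_ee_qshuffle:
  "sum_ee N = (\<Sum>k=0..N. (-1) ^ k \<cdot> qshuffle q (of_word [b, a] ^ k) (of_word [a, b] ^ (N - k)))"
  by (simp add: sum_ee_def alt_prod_def qshuffle_of_word flip: of_word_alt_even atMost_atLeast0)

end

theorem proposition5p9:
  fixes q :: "'a::field_char_0" and n :: nat
  assumes "q \<noteq> 0" and "\<And>m::nat. m > 0 \<Longrightarrow> q ^ m \<noteq> 1"
  shows "((\<Sum>k=0..2*n+2. (-1)^k \<cdot> qshuffle q (G k) (Gt (2*n+2-k))) =
           ((-1)^(n+1) * qtwo q ^ (2*n+1)) \<cdot>
             (inverse q \<cdot> (of_word [X,Y,Y] * of_word [X,X,Y,Y] ^ n * of_word [X]) +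
              q \<cdot> (of_word [Y] * of_word [X,X,Y,Y] ^ n * of_word [X,X,Y]))) \<and>
         ((\<Sum>k=0..2*n+2. (-1)^k \<cdot> qshuffle q (Gt (2*n+2-k)) (G k)) =
           ((-1)^(n+1) * qtwo q ^ (2*n+1)) \<cdot>
             (q \<cdot> (of_word [X,Y,Y] * of_word [X,X,Y,Y] ^ n * of_word [X]) +
              inverse q \<cdot> (of_word [Y] * of_word [X,X,Y,Y] ^ n * of_word [X,X,Y]))) \<and>
         ((\<Sum>k=0..2*n+1. (-1)^k \<cdot> qshuffle q (G k) (Gt (2*n+1-k))) =
           ((-1)^n * qtwo q ^ (2*n)) \<cdot>
             (of_word [X] * of_word [Y,Y,X,X] ^ n * of_word [Y] -
              of_word [Y] * of_word [X,X,Y,Y] ^ n * of_word [X])) \<and>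
         ((\<Sum>k=0..2*n+1. (-1)^k \<cdot> qshuffle q (Gt (2*n+1-k)) (G k)) =
           ((-1)^n * qtwo q ^ (2*n)) \<cdot>
             (of_word [X] * of_word [Y,Y,X,X] ^ n * of_word [Y] -
              of_word [Y] * of_word [X,X,Y,Y] ^ n * of_word [X]))"
proof -
  have GGt: "(\<Sum>k=0..N. (-1)^k \<cdot> qshuffle q (G k) (Gt (N - k))) = sum_ee q X Y N" for N
    using assms(1) by (simp add: sum_ee_qshuffle G_def Gt_def)
  \<comment> \<open>Reversing the summation index puts \<open>Gt\<close> in the role of
    \<open>G\<close> with the letters exchanged, at the cost of the global sign
    \<open>(-1) ^ N\<close>.\<close>
  have GtG: "(\<Sum>k=0..N. (-1)^k \<cdot> qshuffle q (Gt (N - k)) (G k)) = (-1) ^ N \<cdot> sum_ee q Y X N" for N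
  proof -
    have "(\<Sum>k=0..N. (-1)^k \<cdot> qshuffle q (Gt (N - k)) (G k)) =
        (\<Sum>k=0..N. (-1)^(N - k) \<cdot> qshuffle q (Gt k) (G (N - k)))"
      by (subst sum.atLeastAtMost_rev) simp
    also have "\<dots> = (\<Sum>k=0..N. (-1)^N \<cdot> (-1)^k \<cdot> qshuffle q (Gt k) (G (N - k)))"
      by (intro sum.cong refl) (simp add: scale_scale minus_one_power_iff)
    finally show ?thesis
      using assms(1) by (simp add: sum_ee_qshuffle G_def Gt_def scale_sum)
  qed
  have XY: "X \<noteq> Y" and YX: "Y \<noteq> X" by simp_all
  note q = assms(1)
  have e: "(-1) ^ (2 * n + 2) = (1 :: 'a)" and o: "(-1) ^ (2 * n + 1) = (- 1 :: 'a)"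
    by simp_all
  show ?thesis
    \<comment> \<open>For exchanged letters, sliding interchanges the two words of the even case, so
      \<open>q\<close> and \<open>inverse q\<close> trade places; in the odd case the global sign
      undoes the reversed difference.\<close>
    unfolding GGt GtG sum_ee_even[OF q XY] sum_ee_odd[OF q XY] sum_ee_even[OF q YX]
      sum_ee_odd[OF q YX] e o of_word_slide[of Y X] of_word_slide[of X Y, symmetric] scale_minus_left scale_one
    by (simp only: scale_minus_right[symmetric] minus_diff_eq add.commute)
qed

end
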